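(* Let $\mathfrak g=\mathbb{R}\oplus\mathfrak s$, $\mathfrak s=[\mathfrak g,\mathfrak g]$, be a (finite-dimensional, real) reductive Lie algebra with one-dimensional center and $\langle\cdot,\cdot\rangle$ a scalar product on $\mathfrak g$. Then any modification $\mathfrak g_\phi$ of $(\mathfrak g,\langle\cdot,\cdot\rangle)$ is isomorphic to $\mathfrak g$ as a Lie algebra.
   Context: A Riemannian Lie algebra $(\mathfrak g,\langle\cdot,\cdot\rangle)$ is a real Lie algebra endowed with a (positive definite) scalar product. Let $\mathrm{Der}_{\mathfrak{so}}(\mathfrak g)=\mathrm{Der}(\mathfrak g)\cap\mathfrak{so}(\mathfrak g)$ be the Lie algebra of skew-symmetric derivations. A modification of $(\mathfrak g,\langle\cdot,\cdot\rangle)$ is a Lie algebra homomorphism $\phi:\mathfrak g\to\mathrm{Der}_{\mathfrak{so}}(\mathfrak g)$ such that $\phi([\mathfrak g,\mathfrak g])=0$ and $\phi(\mathrm{Im}\,\phi(\mathfrak g))=0$, where $\mathrm{Im}\,\phi(\mathfrak g)=\{AX\mid A\in\phi(\mathfrak g),X\in\mathfrak g\}$. The Lie algebra $\mathfrak g_\phi$, also called a modification of $(\mathfrak g,\langle\cdot,\cdot\rangle)$, is the vector space $\mathfrak g$ with the Lie bracket $[X,Y]_\phi=[X,Y]+\phi(X)Y-\phi(Y)X$. *)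

theory Defs
  imports "HOL-Analysis.Analysis"
begin

text \<open>
  A finite-dimensional real Lie algebra is a Lie bracket on a type of class
  \<^class>\<open>euclidean_space\<close>. The inner product of the type plays the role of the scalar
  product; no compatibility between it and the bracket is assumed, so it stands for an
  arbitrary scalar product on the Lie algebra.
\<close>

definition lie_algebra :: "('a::real_vector \<Rightarrow> 'a \<Rightarrow> 'a) \<Rightarrow> bool" where
  "lie_algebra br \<longleftrightarrow>
     bilinear br \<and> (\<forall>x. br x x = 0) \<and>
     (\<forall>x y z. br x (br y z) + br y (br z x) + br z (br x y) = 0)"

definition lie_center :: "('a::real_vector \<Rightarrow> 'a \<Rightarrow> 'a) \<Rightarrow> 'a set" where
  "lie_center br = {x. \<forall>y. br x y = 0}"

definition lie_derived :: "('a::real_vector \<Rightarrow> 'a \<Rightarrow> 'a) \<Rightarrow> 'a set" where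
  "lie_derived br = span {br x y | x y. True}"

definition lie_ideal :: "('a::real_vector \<Rightarrow> 'a \<Rightarrow> 'a) \<Rightarrow> 'a set \<Rightarrow> bool" where
  "lie_ideal br I \<longleftrightarrow> subspace I \<and> (\<forall>x. \<forall>y\<in>I. br x y \<in> I)"

definition complementary :: "'a::real_vector set \<Rightarrow> 'a set \<Rightarrow> bool" where
  "complementary U V \<longleftrightarrow>
     subspace U \<and> subspace V \<and> U \<inter> V = {0} \<and> {u + v | u v. u \<in> U \<and> v \<in> V} = UNIV"

text \<open>Reductive: the adjoint representation is completely reducible.\<close>

definition lie_reductive :: "('a::real_vector \<Rightarrow> 'a \<Rightarrow> 'a) \<Rightarrow> bool" where
  "lie_reductive br \<longleftrightarrow>
     (\<forall>I. lie_ideal br I \<longrightarrow> (\<exists>J. lie_ideal br J \<and> complementary I J))"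

definition derivations :: "('a::real_vector \<Rightarrow> 'a \<Rightarrow> 'a) \<Rightarrow> ('a \<Rightarrow> 'a) set" where
  "derivations br = {D. linear D \<and> (\<forall>x y. D (br x y) = br (D x) y + br x (D y))}"

definition skew_endomorphisms :: "('a::real_inner \<Rightarrow> 'a) set" where
  "skew_endomorphisms = {D. linear D \<and> (\<forall>x y. D x \<bullet> y = - (x \<bullet> D y))}"

definition skew_derivations :: "('a::real_inner \<Rightarrow> 'a \<Rightarrow> 'a) \<Rightarrow> ('a \<Rightarrow> 'a) set" where
  "skew_derivations br = derivations br \<inter> skew_endomorphisms"

text \<open>
  The first three conjuncts say that \<open>\<phi>\<close> is a Lie algebra homomorphism into
  \<^term>\<open>skew_derivations br\<close> with the commutator bracket; linearity of \<open>\<phi>\<close> is expressed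
  pointwise because functions do not form a real vector space in the type class sense.
\<close>

definition modification ::
  "('a::real_inner \<Rightarrow> 'a \<Rightarrow> 'a) \<Rightarrow> ('a \<Rightarrow> 'a \<Rightarrow> 'a) \<Rightarrow> bool" where
  "modification br \<phi> \<longleftrightarrow>
     (\<forall>x. \<phi> x \<in> skew_derivations br) \<and>
     (\<forall>v. linear (\<lambda>x. \<phi> x v)) \<and>
     (\<forall>x y v. \<phi> (br x y) v = \<phi> x (\<phi> y v) - \<phi> y (\<phi> x v)) \<and>
     (\<forall>z \<in> lie_derived br. \<forall>v. \<phi> z v = 0) \<and>
     (\<forall>z \<in> {\<phi> x w | x w. True}. \<forall>v. \<phi> z v = 0)"

definition modified_bracket ::
  "('a::real_vector \<Rightarrow> 'a \<Rightarrow> 'a) \<Rightarrow> ('a \<Rightarrow> 'a \<Rightarrow> 'a) \<Rightarrow> 'a \<Rightarrow> 'a \<Rightarrow> 'a" where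
  "modified_bracket br \<phi> x y = br x y + \<phi> x y - \<phi> y x"

definition lie_isomorphic ::
  "('a::real_vector \<Rightarrow> 'a \<Rightarrow> 'a) \<Rightarrow> ('b::real_vector \<Rightarrow> 'b \<Rightarrow> 'b) \<Rightarrow> bool" where
  "lie_isomorphic br br' \<longleftrightarrow>
     (\<exists>f. linear f \<and> bij f \<and> (\<forall>x y. f (br x y) = br' (f x) (f y)))"

lemma lie_algebra_modified_bracket:
  assumes L: "lie_algebra br" and M: "modification br \<phi>"
  shows "lie_algebra (modified_bracket br \<phi>)"
proof -
  have l2: "linear (\<phi> x)" and der: "\<phi> x (br y z) = br (\<phi> x y) z + br y (\<phi> x z)"
    for x y z
    using M by (auto simp: modification_def skew_derivations_def derivations_def)
  have l1: "linear (\<lambda>x. \<phi> x v)" for v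
    using M by (simp add: modification_def)
  have hom: "\<phi> (br x y) v = \<phi> x (\<phi> y v) - \<phi> y (\<phi> x v)" for x y v
    using M by (simp add: modification_def)
  have zd: "\<phi> (br x y) v = 0" for x y v
  proof -
    have "br x y \<in> lie_derived br"
      unfolding lie_derived_def by (rule span_base) blast
    then show ?thesis using M unfolding modification_def by blast
  qed
  have zi: "\<phi> (\<phi> x w) v = 0" for x w v
    using M unfolding modification_def by blast
  have comm: "\<phi> x (\<phi> y v) = \<phi> y (\<phi> x v)" for x y v
    using hom[of x y v] zd[of x y v] by simp
  have bl: "bilinear br" and alt: "br x x = 0"
    and jac: "br x (br y z) + br y (br z x) + br z (br x y) = 0" for x y z
    using L by (auto simp: lie_algebra_def)
  note bls = bilinear_ladd[OF bl] bilinear_radd[OF bl] bilinear_lsub[OF bl] bilinear_rsub[OF bl]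
    bilinear_lmul[OF bl] bilinear_rmul[OF bl]
  note ls = linear_add[OF l2] linear_diff[OF l2] linear_scale[OF l2]
    linear_add[OF l1] linear_diff[OF l1] linear_scale[OF l1]
  have anti: "br x y = - br y x" for x y
    using alt[of "x + y"] alt[of x] alt[of y] by (simp add: bls eq_neg_iff_add_eq_0 add.commute)
  have "bilinear (modified_bracket br \<phi>)"
    unfolding bilinear_def modified_bracket_def
    by (intro conjI allI linearI) (simp_all add: bls ls algebra_simps)
  moreover have "modified_bracket br \<phi> x x = 0" for x
    by (simp add: modified_bracket_def alt)
  moreover have "modified_bracket br \<phi> x (modified_bracket br \<phi> y z)
      + modified_bracket br \<phi> y (modified_bracket br \<phi> z x)
      + modified_bracket br \<phi> z (modified_bracket br \<phi> x y) = 0" for x y z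
    using jac[of x y z] comm[of x y z] comm[of y z x] comm[of z x y]
      anti[of "\<phi> x y" z] anti[of "\<phi> y z" x] anti[of "\<phi> z x" y]
      anti[of "\<phi> y x" z] anti[of "\<phi> z y" x] anti[of "\<phi> x z" y]
    by (simp add: modified_bracket_def bls ls zd zi der algebra_simps)
  ultimately show ?thesis by (simp add: lie_algebra_def)
qed

end

theory Submission
  imports Defs "Jordan_Normal_Form.Jordan_Normal_Form_Existence"
begin

text \<open>
  Write \<open>\<gg>\<close> for the Lie algebra, with one-dimensional centre spanned by \<open>e\<close> and derived algebra
  \<open>\<ss>\<close>, and let \<open>a\<close> be the coordinate along \<open>e\<close> in \<open>\<gg> = \<real>e \<oplus> \<ss>\<close>. Since \<open>\<phi>\<close> vanishes on \<open>\<ss>\<close>,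
  \<open>\<phi> x = a x D\<close> with \<open>D = \<phi> e\<close> a skew derivation. A derivation preserves the centre, so \<open>D e\<close> is a
  multiple of \<open>e\<close>, and skewness forces \<open>D e = 0\<close>. If moreover \<open>D\<close> is inner on \<open>\<ss>\<close>, then \<open>D = ad w\<close> on
  all of \<open>\<gg>\<close> for some \<open>w \<in> \<ss>\<close>, and \<open>x \<mapsto> x + a x w\<close> carries the modified bracket to the original
  one: both \<open>[x, y]\<^sub>\<phi>\<close> and \<open>[x + a x w, y + a y w]\<close> equal \<open>[x, y] + a x [w, y] - a y [w, x]\<close>.

  The substance is therefore that derivations of \<open>\<gg>\<close> are inner on \<open>\<ss>\<close>. This follows in the usual way
  once the radical \<open>N\<close> of the Killing form of \<open>\<gg>\<close> is known to be central: the functional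
  \<open>y \<mapsto> tr (D ad y)\<close> then has the form \<open>K(w, \<cdot>)\<close>, and \<open>E = D - ad w\<close> satisfies
  \<open>K(E x, y) = tr (E ad [x, y]) = 0\<close>, so that \<open>E\<close> has central values and kills commutators
  (\<open>trace_ad_eq_killing\<close>, \<open>derivation_inner_on_derived\<close>).

  That \<open>N\<close> is central (\<open>radical_subset_center\<close>) is Cartan's criterion in the form needed here. For \<open>x\<close>
  in the ideal \<open>M = [\<gg>, N]\<close> one has \<open>tr (D ad x) = 0\<close> for every derivation \<open>D\<close>. The key lemma
  \<open>nilpotent_if_trace_orthogonal_to_derivations\<close> deduces that \<open>ad x\<close> is nilpotent: the operator \<open>F\<close>
  acting on the generalised \<open>\<alpha>\<close>-eigenspace of \<open>ad x\<close> as multiplication by the complex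
  conjugate of \<open>\<alpha>\<close> is a derivation of the complexification, because conjugation is additive, and
  \<open>tr (F ad x)\<close> is the sum of the \<open>|\<alpha>|\<^sup>2\<close>, counted with multiplicity, which
  must vanish. By Engel's theorem a nonzero \<open>M\<close> would contain some
  \<open>z \<noteq> 0\<close> with \<open>[M, z] = 0\<close>; a complementary ideal of \<open>M\<close> commutes with \<open>M\<close>, so \<open>z\<close> would be central
  as well as in \<open>\<ss>\<close>. Hence \<open>M = 0\<close>.
\<close>

(* The matrix library reuses the dot and the name subspace; both mean the real notions below. *)
no_notation scalar_prod (infix \<open>\<bullet>\<close> 70)
hide_const (open) VectorSpace.subspace

section \<open>Jordan coordinates of a real operator\<close>


lemma jordan_matrix_offdiag:
  assumes "i < sum_list (map fst n_as)" "j < sum_list (map fst n_as)" "i \<noteq> j"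
    and "jordan_matrix n_as $$ (i, j) \<noteq> (0 :: 'b::zero_neq_one)"
  shows "j = Suc i \<and> jordan_matrix n_as $$ (i, i) = jordan_matrix n_as $$ (j, j)"
  using assms
proof (induction n_as arbitrary: i j)
  case Nil
  then show ?case by simp
next
  case (Cons p n_as)
  obtain n a where p: "p = (n, a)" by (cases p)
  let ?N = "sum_list (map fst n_as)"
  have ent: "jordan_matrix (p # n_as) $$ (r, s) =
      (if r < n then if s < n then jordan_block n a $$ (r, s) else 0
       else if s < n then 0 else jordan_matrix n_as $$ (r - n, s - n))"
    if "r < n + ?N" "s < n + ?N" for r s
    using that by (subst p, subst jordan_matrix_Cons, subst index_mat_four_block) auto
  have ij: "i < n + ?N" "j < n + ?N"
    using Cons.prems p by auto
  show ?case
  proof (cases "i < n")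
    case True
    then show ?thesis
      using Cons.prems ent ij by (auto split: if_splits)
  next
    case False
    have "\<not> j < n"
      using False Cons.prems ent ij by auto
    have "i - n < ?N" "j - n < ?N" "i - n \<noteq> j - n"
      using ij False \<open>\<not> j < n\<close> Cons.prems(3) by auto
    moreover have "jordan_matrix n_as $$ (i - n, j - n) \<noteq> 0"
      using Cons.prems(4) ent[OF ij] False \<open>\<not> j < n\<close> by simp
    ultimately have IH: "j - n = Suc (i - n)"
        "jordan_matrix n_as $$ (i - n, i - n) = jordan_matrix n_as $$ (j - n, j - n)"
      using Cons.IH[of "i - n" "j - n"] by blast+
    have "jordan_matrix (p # n_as) $$ (i, i) = jordan_matrix n_as $$ (i - n, i - n)"
      using ent[OF ij(1) ij(1)] False by simp
    also note IH(2)
    also have "jordan_matrix n_as $$ (j - n, j - n) = jordan_matrix (p # n_as) $$ (j, j)"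
      using ent[OF ij(2) ij(2)] \<open>\<not> j < n\<close> by simp
    finally show ?thesis
      using IH(1) False \<open>\<not> j < n\<close> by arith
  qed
qed

text \<open>
  The complex Jordan normal form of a real operator, without matrices. The functionals \<open>\<zeta> k\<close> are the
  complex coordinates with respect to a Jordan basis of the complexification, restricted to real
  vectors; \<open>\<pi> k b\<close> is the \<open>b\<close>-component of the \<open>k\<close>-th basis vector. The last two properties say that
  the two families are inverse to each other. A superdiagonal entry \<open>\<epsilon> k\<close> can be nonzero only inside a
  Jordan block, where the eigenvalue \<open>\<mu>\<close> is constant.
\<close>

lemma jordan_coordinates:
  fixes T :: "'a::euclidean_space \<Rightarrow> 'a"
  assumes T: "linear T"
  obtains n :: nat and \<zeta> \<pi> :: "nat \<Rightarrow> 'a \<Rightarrow> complex" and \<mu> \<epsilon> :: "nat \<Rightarrow> complex"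
  where "\<And>k. linear (\<zeta> k)"
    and "\<And>k v. k < n \<Longrightarrow> \<zeta> k (T v) = \<mu> k * \<zeta> k v + \<epsilon> k * \<zeta> (Suc k) v"
    and "\<And>k. \<epsilon> k \<noteq> 0 \<Longrightarrow> Suc k < n \<and> \<mu> (Suc k) = \<mu> k"
    and "\<And>k l. k < n \<Longrightarrow> l < n \<Longrightarrow>
           (\<Sum>b\<in>Basis. \<pi> l b * \<zeta> k b) = (if k = l then 1 else 0)"
    and "\<And>b v. b \<in> Basis \<Longrightarrow> (\<Sum>k<n. \<pi> k b * \<zeta> k v) = of_real (v \<bullet> b)"
proof -
  define n where "n = card (Basis :: 'a set)"
  obtain h where h: "bij_betw h {..<n} (Basis :: 'a set)"
    using ex_bij_betw_nat_finite[OF finite_Basis] unfolding n_def atLeast0LessThan by blast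
  have sumB: "(\<Sum>b\<in>Basis. g b) = (\<Sum>i<n. g (h i))" for g :: "'a \<Rightarrow> complex"
    using sum.reindex_bij_betw[OF h, of g] by simp
  have hB: "h i \<in> Basis" if "i < n" for i
    using h that by (auto simp: bij_betw_def)
  have hinj: "h i = h j \<longleftrightarrow> i = j" if "i < n" "j < n" for i j
    using h that by (auto simp: bij_betw_def inj_on_def)
  have hh: "h i \<bullet> h j = (if i = j then 1 else 0)" if "i < n" "j < n" for i j
    using that by (simp add: inner_Basis hB hinj)
  define A where "A = mat n n (\<lambda>(i, j). complex_of_real (T (h j) \<bullet> h i))"
  have A: "A \<in> carrier_mat n n" by (simp add: A_def)
  obtain as where "char_poly A = (\<Prod>a\<leftarrow>as. [:- a, 1:])"
    using char_poly_factorized[OF A] by blast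
  from jordan_nf_exists[OF A this] obtain n_as where "jordan_nf A n_as" ..
  then obtain P Q where "similar_mat_wit A (jordan_matrix n_as) P Q"
    unfolding jordan_nf_def similar_mat_def by blast
  then have J: "jordan_matrix n_as \<in> carrier_mat n n"
    and P: "P \<in> carrier_mat n n" and Q: "Q \<in> carrier_mat n n"
    and PQ: "P * Q = 1\<^sub>m n" and QP: "Q * P = 1\<^sub>m n"
    and APJQ: "A = P * jordan_matrix n_as * Q"
    using A by (auto simp: similar_mat_wit_def Let_def)
  define J where "J = jordan_matrix n_as"
  note J = J[folded J_def] and APJQ = APJQ[folded J_def]
  have N: "sum_list (map fst n_as) = n"
    using J unfolding J_def by auto
  have QA: "Q * A = J * Q"
  proof -
    have "Q * A = (Q * P) * (J * Q)"
      using P Q J unfolding APJQ by (simp add: assoc_mult_mat[of _ n n _ n _ n])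
    then show ?thesis
      using Q J QP by simp
  qed
  define \<zeta> where "\<zeta> k v = (\<Sum>j<n. Q $$ (k, j) * complex_of_real (v \<bullet> h j))" for k v
  define \<pi> where "\<pi> k v = (\<Sum>i<n. P $$ (i, k) * complex_of_real (v \<bullet> h i))" for k v
  define \<mu> where "\<mu> k = J $$ (k, k)" for k
  define \<epsilon> where "\<epsilon> k = (if Suc k < n then J $$ (k, Suc k) else 0)" for k
  have \<zeta>h: "\<zeta> k (h j) = Q $$ (k, j)" if "j < n" for k j
  proof -
    have "\<zeta> k (h j) = (\<Sum>i<n. if i = j then Q $$ (k, i) else 0)"
      unfolding \<zeta>_def by (rule sum.cong) (use that hh in auto)
    then show ?thesis using that by simp
  qed
  have \<pi>h: "\<pi> k (h j) = P $$ (j, k)" if "j < n" for k j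
  proof -
    have "\<pi> k (h j) = (\<Sum>i<n. if i = j then P $$ (i, k) else 0)"
      unfolding \<pi>_def by (rule sum.cong) (use that hh in auto)
    then show ?thesis using that by simp
  qed
  have lin: "linear (\<zeta> k)" for k
    unfolding \<zeta>_def
    by (rule linearI)
      (simp_all add: inner_add_left distrib_left sum.distrib scaleR_conv_of_real sum_distrib_left
        mult_ac)
  have mm: "(X * Y) $$ (i, j) = (\<Sum>k<n. X $$ (i, k) * Y $$ (k, j))"
    if "X \<in> carrier_mat n n" "Y \<in> carrier_mat n n" "i < n" "j < n" for X Y :: "complex mat" and i j
    using that by (auto simp: scalar_prod_def atLeast0LessThan intro!: sum.cong)
  have step: "\<zeta> k (T (h j)) = \<mu> k * \<zeta> k (h j) + \<epsilon> k * \<zeta> (Suc k) (h j)"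
    if k: "k < n" and j: "j < n" for k j
  proof -
    have "\<zeta> k (T (h j)) = (Q * A) $$ (k, j)"
      using k j by (simp add: mm[OF Q A]) (auto simp: \<zeta>_def A_def intro!: sum.cong)
    also have "\<dots> = (\<Sum>m<n. J $$ (k, m) * Q $$ (m, j))"
      using k j by (simp add: QA mm[OF J Q])
    also have "\<dots> = (\<Sum>m<n. (if m = k then \<mu> k * Q $$ (k, j) else 0) +
        (if m = Suc k then \<epsilon> k * Q $$ (Suc k, j) else 0))"
    proof (rule sum.cong[OF refl])
      fix m assume "m \<in> {..<n}"
      moreover from this have "J $$ (k, m) = 0" if "m \<noteq> k" "m \<noteq> Suc k"
        using jordan_matrix_offdiag[of k n_as m] k that unfolding N J_def by blast
      ultimately show "J $$ (k, m) * Q $$ (m, j) = (if m = k then \<mu> k * Q $$ (k, j) else 0) +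
          (if m = Suc k then \<epsilon> k * Q $$ (Suc k, j) else 0)"
        by (simp add: \<mu>_def \<epsilon>_def)
    qed
    also have "\<dots> = \<mu> k * Q $$ (k, j) + \<epsilon> k * Q $$ (Suc k, j)"
      using k by (simp add: sum.distrib \<epsilon>_def)
    finally show ?thesis using j by (simp add: \<zeta>h)
  qed
  have lc: "linear (\<lambda>v. \<mu> k * \<zeta> k v + \<epsilon> k * \<zeta> (Suc k) v)" for k
    by (rule linearI)
      (simp_all add: linear_add[OF lin] linear_scale[OF lin] algebra_simps)
  show thesis
  proof (rule that[of \<zeta> n \<mu> \<epsilon> \<pi>])
    show "linear (\<zeta> k)" for k by (rule lin)
    show "\<zeta> k (T v) = \<mu> k * \<zeta> k v + \<epsilon> k * \<zeta> (Suc k) v" if k: "k < n" for k v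
    proof -
      have "(\<lambda>v. \<zeta> k (T v)) = (\<lambda>v. \<mu> k * \<zeta> k v + \<epsilon> k * \<zeta> (Suc k) v)"
      proof (rule linear_eq_stdbasis)
        show "linear (\<lambda>v. \<zeta> k (T v))"
          using linear_compose[OF T lin] by (simp add: o_def)
        show "linear (\<lambda>v. \<mu> k * \<zeta> k v + \<epsilon> k * \<zeta> (Suc k) v)"
          by (rule lc)
        fix b :: 'a assume "b \<in> Basis"
        then obtain j where "j < n" "b = h j" using h by (auto simp: bij_betw_def)
        then show "\<zeta> k (T b) = \<mu> k * \<zeta> k b + \<epsilon> k * \<zeta> (Suc k) b"
          using step k by simp
      qed
      then show ?thesis by metis
    qed
    show "Suc k < n \<and> \<mu> (Suc k) = \<mu> k" if "\<epsilon> k \<noteq> 0" for k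
    proof -
      have "Suc k < n" "J $$ (k, Suc k) \<noteq> 0"
        using that by (auto simp: \<epsilon>_def split: if_splits)
      then show ?thesis
        using jordan_matrix_offdiag[of k n_as "Suc k"] unfolding \<mu>_def N J_def by simp
    qed
    show "(\<Sum>b\<in>Basis. \<pi> l b * \<zeta> k b) = (if k = l then 1 else 0)" if "k < n" "l < n" for k l
    proof -
      have "(\<Sum>b\<in>Basis. \<pi> l b * \<zeta> k b) = (\<Sum>i<n. Q $$ (k, i) * P $$ (i, l))"
        unfolding sumB by (rule sum.cong) (auto simp: \<pi>h \<zeta>h)
      also have "\<dots> = (1\<^sub>m n) $$ (k, l)"
        using that by (simp add: mm[OF Q P, symmetric] QP)
      finally show ?thesis using that by simp
    qed
    show "(\<Sum>k<n. \<pi> k b * \<zeta> k v) = of_real (v \<bullet> b)" if "b \<in> Basis" for b v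
    proof -
      obtain i where i: "i < n" "b = h i"
        using h \<open>b \<in> Basis\<close> by (auto simp: bij_betw_def)
      have "(\<Sum>k<n. \<pi> k b * \<zeta> k v) =
          (\<Sum>k<n. \<Sum>j<n. P $$ (i, k) * Q $$ (k, j) * of_real (v \<bullet> h j))"
        by (simp only: i(2) \<pi>h[OF i(1)] \<zeta>_def sum_distrib_left mult.assoc)
      also have "\<dots> = (\<Sum>j<n. (\<Sum>k<n. P $$ (i, k) * Q $$ (k, j)) * of_real (v \<bullet> h j))"
        by (subst sum.swap) (simp only: sum_distrib_right)
      also have "\<dots> = (\<Sum>j<n. if j = i then of_real (v \<bullet> h j) else 0)"
      proof (rule sum.cong[OF refl])
        fix j assume "j \<in> {..<n}"
        then have "(\<Sum>k<n. P $$ (i, k) * Q $$ (k, j)) = (if j = i then 1 else 0)"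
          using i mm[OF P Q, of i j, unfolded PQ] by (simp split: if_splits)
        then show "(\<Sum>k<n. P $$ (i, k) * Q $$ (k, j)) * of_real (v \<bullet> h j) =
            (if j = i then of_real (v \<bullet> h j) else 0)"
          by simp
      qed
      also have "\<dots> = of_real (v \<bullet> h i)"
        using i(1) by simp
      finally show ?thesis by (simp only: i(2))
    qed
  qed
qed

section \<open>Operators orthogonal to all derivations\<close>

text \<open>The trace of an operator, computed in the standard orthonormal basis.\<close>

definition trace_map :: "('a::euclidean_space \<Rightarrow> 'a) \<Rightarrow> real" where
  "trace_map A = (\<Sum>b\<in>Basis. A b \<bullet> b)"

text \<open>
  In Jordan coordinates of \<open>T\<close> let \<open>F\<close> multiply the \<open>k\<close>-th coordinate by the conjugate of \<open>\<mu> k\<close>. The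
  structure constants \<open>\<beta> m k l\<close> of the complexified product vanish unless \<open>\<mu> m = \<mu> k + \<mu> l\<close>, hence
  \<open>F\<close> is a derivation of the complexification, and so are its real and imaginary parts \<open>F1\<close> and \<open>F2\<close>
  as real operators. Orthogonality to both gives \<open>\<Sum>|\<mu> k|\<^sup>2 = tr (F T) = 0\<close>. Nothing but bilinearity
  of the product is used.
\<close>

lemma nilpotent_if_trace_orthogonal_to_derivations:
  fixes br :: "'a::euclidean_space \<Rightarrow> 'a \<Rightarrow> 'a"
  assumes bl: "bilinear br" and T: "T \<in> derivations br"
    and orth: "\<And>D. D \<in> derivations br \<Longrightarrow> trace_map (\<lambda>v. D (T v)) = 0"
  shows "\<exists>m. \<forall>v. (T ^^ m) v = 0"
proof -
  have linT: "linear T" and derT: "T (br x y) = br (T x) y + br x (T y)" for x y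
    using T by (auto simp: derivations_def)
  obtain n :: nat and \<zeta> \<pi> :: "nat \<Rightarrow> 'a \<Rightarrow> complex" and \<mu> \<epsilon> :: "nat \<Rightarrow> complex"
    where lin: "\<And>k. linear (\<zeta> k)"
      and \<zeta>T: "\<And>k v. k < n \<Longrightarrow> \<zeta> k (T v) = \<mu> k * \<zeta> k v + \<epsilon> k * \<zeta> (Suc k) v"
      and link: "\<And>k. \<epsilon> k \<noteq> 0 \<Longrightarrow> Suc k < n \<and> \<mu> (Suc k) = \<mu> k"
      and dual: "\<And>k l. k < n \<Longrightarrow> l < n \<Longrightarrow>
             (\<Sum>b\<in>Basis. \<pi> l b * \<zeta> k b) = (if k = l then 1 else 0)"
      and expand: "\<And>b v. b \<in> Basis \<Longrightarrow> (\<Sum>k<n. \<pi> k b * \<zeta> k v) = of_real (v \<bullet> b)"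
    by (rule jordan_coordinates[OF linT]) (rule that)
  note \<zeta>l = linear_add[OF lin] linear_diff[OF lin] linear_scale[OF lin] linear_0[OF lin]
  note bls = bilinear_ladd[OF bl] bilinear_radd[OF bl] bilinear_lsub[OF bl] bilinear_rsub[OF bl]
    bilinear_lmul[OF bl] bilinear_rmul[OF bl]

  \<comment> \<open>the \<open>m\<close>-th coordinate of the product of the \<open>k\<close>-th and \<open>l\<close>-th Jordan basis vectors\<close>
  define \<beta> where "\<beta> m k l = (\<Sum>b\<in>Basis. \<Sum>c\<in>Basis. \<pi> k b * \<pi> l c * \<zeta> m (br b c))" for m k l
  have br_coord: "\<zeta> m (br u v) = (\<Sum>k<n. \<Sum>l<n. \<beta> m k l * \<zeta> k u * \<zeta> l v)" for m u v
  proof -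
    have "br u v = br (\<Sum>b\<in>Basis. (u \<bullet> b) *\<^sub>R b) (\<Sum>c\<in>Basis. (v \<bullet> c) *\<^sub>R c)"
      by (simp add: euclidean_representation)
    also have "\<dots> = (\<Sum>b\<in>Basis. \<Sum>c\<in>Basis. (u \<bullet> b) *\<^sub>R (v \<bullet> c) *\<^sub>R br b c)"
      by (simp add: bilinear_sum[OF bl] sum.cartesian_product bls mult.commute)
    finally have "\<zeta> m (br u v) =
        (\<Sum>b\<in>Basis. \<Sum>c\<in>Basis. of_real (u \<bullet> b) * of_real (v \<bullet> c) * \<zeta> m (br b c))"
      by (simp add: linear_sum[OF lin] \<zeta>l scaleR_conv_of_real mult_ac)
    also have "\<dots> = (\<Sum>b\<in>Basis. \<Sum>c\<in>Basis. \<Sum>k<n. \<Sum>l<n.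
        (\<pi> k b * \<zeta> k u) * (\<pi> l c * \<zeta> l v) * \<zeta> m (br b c))"
      by (intro sum.cong refl, simp only: expand[symmetric] sum_product, simp only: sum_distrib_right)
    also have "\<dots> = (\<Sum>b\<in>Basis. \<Sum>k<n. \<Sum>l<n. \<Sum>c\<in>Basis.
        (\<pi> k b * \<zeta> k u) * (\<pi> l c * \<zeta> l v) * \<zeta> m (br b c))"
      by (intro sum.cong refl) (simp add: sum.swap[of _ "{..<n}" Basis])
    also have "\<dots> = (\<Sum>k<n. \<Sum>l<n. \<Sum>b\<in>Basis. \<Sum>c\<in>Basis.
        (\<pi> k b * \<zeta> k u) * (\<pi> l c * \<zeta> l v) * \<zeta> m (br b c))"
      by (simp add: sum.swap[of _ "{..<n}" Basis])
    also have "\<dots> = (\<Sum>k<n. \<Sum>l<n. \<beta> m k l * \<zeta> k u * \<zeta> l v)"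
      by (simp add: \<beta>_def sum_distrib_left sum_distrib_right mult_ac)
    finally show ?thesis .
  qed

  \<comment> \<open>the entries of \<open>T\<close> in Jordan coordinates\<close>
  define M where "M k j = (\<Sum>b\<in>Basis. \<pi> k b * \<zeta> j (T b))" for k j
  have M: "M k j = (if j = k then \<mu> j else 0) + (if Suc j = k then \<epsilon> j else 0)"
    if "k < n" "j < n" for k j
  proof -
    have "M k j = \<mu> j * (\<Sum>b\<in>Basis. \<pi> k b * \<zeta> j b) + \<epsilon> j * (\<Sum>b\<in>Basis. \<pi> k b * \<zeta> (Suc j) b)"
      using that by (simp add: M_def \<zeta>T sum_distrib_left sum.distrib algebra_simps)
    then show ?thesis
      using that link[of j] by (cases "\<epsilon> j = 0") (auto simp: dual)
  qed
  have sumM: "(\<Sum>j<n. M k j * g j) = \<mu> k * g k + (if k = 0 then 0 else \<epsilon> (k - 1) * g (k - 1))"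
    if k: "k < n" for k g
  proof -
    have "(\<Sum>j<n. M k j * g j) = (\<Sum>j<n. (if j = k then \<mu> j * g j else 0) +
        (if j = k - 1 then if k = 0 then 0 else \<epsilon> j * g j else 0))"
      by (rule sum.cong) (use k in \<open>auto simp: M algebra_simps\<close>)
    also have "\<dots> = \<mu> k * g k + (if k = 0 then 0 else \<epsilon> (k - 1) * g (k - 1))"
      using k by (simp add: sum.distrib)
    finally show ?thesis .
  qed
  have sep: "(\<Sum>b\<in>Basis. \<Sum>c\<in>Basis. \<pi> k b * \<pi> l c * \<zeta> m (br (f b) (g c))) =
      (\<Sum>i<n. \<Sum>j<n. \<beta> m i j * (\<Sum>b\<in>Basis. \<pi> k b * \<zeta> i (f b)) * (\<Sum>c\<in>Basis. \<pi> l c * \<zeta> j (g c)))"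
    for k l m f g
  proof -
    have "(\<Sum>b\<in>Basis. \<Sum>c\<in>Basis. \<pi> k b * \<pi> l c * \<zeta> m (br (f b) (g c))) =
        (\<Sum>b\<in>Basis. \<Sum>c\<in>Basis. \<Sum>i<n. \<Sum>j<n.
          \<beta> m i j * (\<pi> k b * \<zeta> i (f b)) * (\<pi> l c * \<zeta> j (g c)))"
      by (simp add: br_coord sum_distrib_left mult_ac)
    also have "\<dots> = (\<Sum>b\<in>Basis. \<Sum>i<n. \<Sum>j<n. \<Sum>c\<in>Basis.
          \<beta> m i j * (\<pi> k b * \<zeta> i (f b)) * (\<pi> l c * \<zeta> j (g c)))"
      by (intro sum.cong refl) (simp add: sum.swap[of _ "{..<n}" Basis])
    also have "\<dots> = (\<Sum>i<n. \<Sum>j<n. \<Sum>b\<in>Basis. \<Sum>c\<in>Basis.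
          \<beta> m i j * (\<pi> k b * \<zeta> i (f b)) * (\<pi> l c * \<zeta> j (g c)))"
      by (simp add: sum.swap[of _ "{..<n}" Basis])
    finally show ?thesis
      by (simp add: sum_product sum_distrib_left mult_ac)
  qed
  have left: "(\<Sum>b\<in>Basis. \<Sum>c\<in>Basis. \<pi> k b * \<pi> l c * \<zeta> m (br (T b) c)) = (\<Sum>j<n. M k j * \<beta> m j l)"
    if "k < n" "l < n" for k l m
  proof -
    have "(\<Sum>b\<in>Basis. \<Sum>c\<in>Basis. \<pi> k b * \<pi> l c * \<zeta> m (br (T b) c)) =
        (\<Sum>i<n. \<Sum>j<n. if j = l then \<beta> m i j * M k i else 0)"
      unfolding sep[of k l m T "\<lambda>c. c"] M_def[symmetric]
      by (intro sum.cong refl) (use that in \<open>auto simp: dual\<close>)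
    then show ?thesis using that by (simp add: mult.commute)
  qed
  have right: "(\<Sum>b\<in>Basis. \<Sum>c\<in>Basis. \<pi> k b * \<pi> l c * \<zeta> m (br b (T c))) = (\<Sum>j<n. M l j * \<beta> m k j)"
    if "k < n" "l < n" for k l m
  proof -
    have "(\<Sum>b\<in>Basis. \<Sum>c\<in>Basis. \<pi> k b * \<pi> l c * \<zeta> m (br b (T c))) =
        (\<Sum>i<n. if i = k then \<Sum>j<n. \<beta> m i j * M l j else 0)"
      unfolding sep[of k l m "\<lambda>b. b" T] M_def[symmetric]
      by (intro sum.cong refl) (use that in \<open>auto simp: dual\<close>)
    then show ?thesis using that by (simp add: mult.commute)
  qed
  have rec: "\<mu> m * \<beta> m k l + \<epsilon> m * \<beta> (Suc m) k l =
      (\<Sum>j<n. M k j * \<beta> m j l) + (\<Sum>j<n. M l j * \<beta> m k j)"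
    if "k < n" "l < n" "m < n" for k l m
  proof -
    have "\<mu> m * \<beta> m k l + \<epsilon> m * \<beta> (Suc m) k l =
        (\<Sum>b\<in>Basis. \<Sum>c\<in>Basis. \<pi> k b * \<pi> l c * \<zeta> m (T (br b c)))"
      using that by (simp add: \<beta>_def \<zeta>T sum_distrib_left sum.distrib algebra_simps)
    also have "\<dots> = (\<Sum>b\<in>Basis. \<Sum>c\<in>Basis. \<pi> k b * \<pi> l c * \<zeta> m (br (T b) c)) +
        (\<Sum>b\<in>Basis. \<Sum>c\<in>Basis. \<pi> k b * \<pi> l c * \<zeta> m (br b (T c)))"
      by (simp add: derT \<zeta>l distrib_left sum.distrib)
    finally show ?thesis using that by (simp add: left right)
  qed
  \<comment> \<open>In the derivation identity for \<open>T\<close> the off-diagonal terms involve constants with the same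
    \<open>\<mu> m - \<mu> k - \<mu> l\<close> and smaller \<open>k + l + (n - m)\<close>.\<close>
  have graded: "\<beta> m k l = 0" if "k < n" "l < n" "m < n" "\<mu> m \<noteq> \<mu> k + \<mu> l" for m k l
    using that
  proof (induction "k + l + (n - m)" arbitrary: m k l rule: less_induct)
    case less
    have 1: "\<epsilon> m * \<beta> (Suc m) k l = 0"
      using less.hyps[of k l "Suc m"] less.prems link[of m] by (cases "\<epsilon> m = 0") auto
    have 2: "(if k = 0 then 0 else \<epsilon> (k - 1) * \<beta> m (k - 1) l) = 0"
      using less.hyps[of "k - 1" l m] less.prems link[of "k - 1"] by (cases "\<epsilon> (k - 1) = 0") auto
    have 3: "(if l = 0 then 0 else \<epsilon> (l - 1) * \<beta> m k (l - 1)) = 0"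
      using less.hyps[of k "l - 1" m] less.prems link[of "l - 1"] by (cases "\<epsilon> (l - 1) = 0") auto
    have "\<mu> m * \<beta> m k l = \<mu> k * \<beta> m k l + \<mu> l * \<beta> m k l"
      using rec[of k l m] less.prems 1 2 3 by (simp add: sumM)
    then have "(\<mu> m - (\<mu> k + \<mu> l)) * \<beta> m k l = 0"
      by (simp add: algebra_simps)
    then show ?case using less.prems by simp
  qed

  \<comment> \<open>\<open>G v b\<close> is the \<open>b\<close>-component of \<open>F v\<close>, and \<open>F v = F1 v + \<i> F2 v\<close>.\<close>
  define G where "G v b = (\<Sum>k<n. \<pi> k b * (cnj (\<mu> k) * \<zeta> k v))" for v b
  define F1 where "F1 v = (\<Sum>b\<in>Basis. Re (G v b) *\<^sub>R b)" for v
  define F2 where "F2 v = (\<Sum>b\<in>Basis. Im (G v b) *\<^sub>R b)" for v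
  have Gl: "G (u + v) b = G u b + G v b" "G (r *\<^sub>R v) b = r *\<^sub>R G v b" for u v b r
    by (simp_all add: G_def \<zeta>l sum.distrib scaleR_sum_right algebra_simps)
  have linF: "linear F1" "linear F2"
    by (auto intro!: linearI simp: F1_def F2_def Gl scaleR_add_left sum.distrib scaleR_sum_right)
  have \<zeta>F: "\<zeta> k (F1 v) + \<i> * \<zeta> k (F2 v) = cnj (\<mu> k) * \<zeta> k v" if k: "k < n" for k v
  proof -
    have "\<zeta> k (F1 v) + \<i> * \<zeta> k (F2 v) =
        (\<Sum>b\<in>Basis. (of_real (Re (G v b)) + \<i> * of_real (Im (G v b))) * \<zeta> k b)"
      by (simp add: F1_def F2_def linear_sum[OF lin] \<zeta>l scaleR_conv_of_real sum_distrib_left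
          sum.distrib algebra_simps)
    also have "\<dots> = (\<Sum>b\<in>Basis. \<Sum>l<n. (\<pi> l b * (cnj (\<mu> l) * \<zeta> l v)) * \<zeta> k b)"
      by (simp add: complex_eq[symmetric]) (simp add: G_def sum_distrib_right)
    also have "\<dots> = (\<Sum>l<n. (\<Sum>b\<in>Basis. \<pi> l b * \<zeta> k b) * (cnj (\<mu> l) * \<zeta> l v))"
      by (subst sum.swap) (simp add: sum_distrib_left sum_distrib_right mult_ac)
    also have "\<dots> = (\<Sum>l<n. if l = k then cnj (\<mu> l) * \<zeta> l v else 0)"
      by (rule sum.cong) (use k in \<open>auto simp: dual\<close>)
    finally show ?thesis using k by simp
  qed
  have inj: "x = 0 \<and> y = 0" if "\<And>k. k < n \<Longrightarrow> \<zeta> k x + \<i> * \<zeta> k y = 0" for x y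
  proof -
    have "x \<bullet> b = 0 \<and> y \<bullet> b = 0" if b: "b \<in> Basis" for b
    proof -
      have "of_real (x \<bullet> b) + \<i> * of_real (y \<bullet> b) = (\<Sum>k<n. \<pi> k b * (\<zeta> k x + \<i> * \<zeta> k y))"
        using b by (simp add: expand[symmetric] sum_distrib_left sum.distrib algebra_simps)
      also have "\<dots> = 0"
        using \<open>\<And>k. k < n \<Longrightarrow> \<zeta> k x + \<i> * \<zeta> k y = 0\<close> by simp
      finally show ?thesis by (simp add: complex_eq_iff)
    qed
    then show ?thesis by (meson euclidean_all_zero_iff)
  qed
  have der: "F1 (br u v) = br (F1 u) v + br u (F1 v) \<and> F2 (br u v) = br (F2 u) v + br u (F2 v)"
    for u v
  proof -
    have "\<zeta> m (F1 (br u v) - (br (F1 u) v + br u (F1 v))) +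
        \<i> * \<zeta> m (F2 (br u v) - (br (F2 u) v + br u (F2 v))) = 0" if m: "m < n" for m
    proof -
      have a: "\<zeta> m (br (F1 u) v) + \<i> * \<zeta> m (br (F2 u) v) =
          (\<Sum>k<n. \<Sum>l<n. \<beta> m k l * (cnj (\<mu> k) * \<zeta> k u) * \<zeta> l v)"
      proof -
        have "\<zeta> m (br (F1 u) v) + \<i> * \<zeta> m (br (F2 u) v) =
            (\<Sum>k<n. \<Sum>l<n. \<beta> m k l * (\<zeta> k (F1 u) + \<i> * \<zeta> k (F2 u)) * \<zeta> l v)"
          by (simp add: br_coord sum_distrib_left sum.distrib algebra_simps)
        then show ?thesis by (simp add: \<zeta>F)
      qed
      have b: "\<zeta> m (br u (F1 v)) + \<i> * \<zeta> m (br u (F2 v)) =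
          (\<Sum>k<n. \<Sum>l<n. \<beta> m k l * \<zeta> k u * (cnj (\<mu> l) * \<zeta> l v))"
      proof -
        have "\<zeta> m (br u (F1 v)) + \<i> * \<zeta> m (br u (F2 v)) =
            (\<Sum>k<n. \<Sum>l<n. \<beta> m k l * \<zeta> k u * (\<zeta> l (F1 v) + \<i> * \<zeta> l (F2 v)))"
          by (simp add: br_coord sum_distrib_left sum.distrib algebra_simps)
        then show ?thesis by (simp add: \<zeta>F)
      qed
      have "\<zeta> m (F1 (br u v)) + \<i> * \<zeta> m (F2 (br u v)) =
          (\<Sum>k<n. \<Sum>l<n. cnj (\<mu> m) * (\<beta> m k l * \<zeta> k u * \<zeta> l v))"
        using m by (simp add: \<zeta>F br_coord sum_distrib_left)
      also have "\<dots> = (\<Sum>k<n. \<Sum>l<n. \<beta> m k l * (cnj (\<mu> k) * \<zeta> k u) * \<zeta> l v +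
          \<beta> m k l * \<zeta> k u * (cnj (\<mu> l) * \<zeta> l v))"
      proof (intro sum.cong refl)
        fix k l assume kl: "k \<in> {..<n}" "l \<in> {..<n}"
        show "cnj (\<mu> m) * (\<beta> m k l * \<zeta> k u * \<zeta> l v) =
            \<beta> m k l * (cnj (\<mu> k) * \<zeta> k u) * \<zeta> l v + \<beta> m k l * \<zeta> k u * (cnj (\<mu> l) * \<zeta> l v)"
        proof (cases "\<mu> m = \<mu> k + \<mu> l")
          case True
          then show ?thesis by (simp add: algebra_simps)
        next
          case False
          then show ?thesis using kl m by (simp add: graded)
        qed
      qed
      also have "\<dots> = (\<zeta> m (br (F1 u) v) + \<i> * \<zeta> m (br (F2 u) v)) +
          (\<zeta> m (br u (F1 v)) + \<i> * \<zeta> m (br u (F2 v)))"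
        by (simp add: a b sum.distrib)
      finally show ?thesis by (simp add: \<zeta>l algebra_simps)
    qed
    from inj[OF this] show ?thesis by simp
  qed
  have "F1 \<in> derivations br" "F2 \<in> derivations br"
    using linF der by (auto simp: derivations_def)
  then have tr0: "trace_map (\<lambda>v. F1 (T v)) = 0" "trace_map (\<lambda>v. F2 (T v)) = 0"
    using orth by auto
  have "complex_of_real (\<Sum>k<n. (cmod (\<mu> k))\<^sup>2) = (\<Sum>k<n. cnj (\<mu> k) * M k k)"
    by (simp add: M complex_norm_square mult.commute del: of_real_power)
  also have "\<dots> = (\<Sum>b\<in>Basis. G (T b) b)"
    unfolding M_def G_def by (subst sum.swap) (simp add: sum_distrib_left mult_ac)
  also have "\<dots> = of_real (trace_map (\<lambda>v. F1 (T v))) + \<i> * of_real (trace_map (\<lambda>v. F2 (T v)))"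
    by (simp add: trace_map_def F1_def F2_def complex_eq[symmetric] sum_distrib_left
        flip: sum.distrib)
  also have "\<dots> = 0"
    by (simp add: tr0)
  finally have "(\<Sum>k<n. (cmod (\<mu> k))\<^sup>2) = 0"
    using of_real_eq_0_iff by blast
  then have \<mu>0: "\<mu> k = 0" if "k < n" for k
    using that by (simp add: sum_nonneg_eq_0_iff)
  have van: "\<zeta> k ((T ^^ j) v) = 0" if "k < n" "n \<le> k + j" for j k v
    using that
  proof (induction j arbitrary: k)
    case 0
    then show ?case by simp
  next
    case (Suc j)
    then show ?case
      using link[of k] by (cases "\<epsilon> k = 0") (simp_all add: \<zeta>T \<mu>0)
  qed
  have "(T ^^ n) v = 0" for v
    using inj[of "(T ^^ n) v" 0] van by (simp add: \<zeta>l)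
  then show ?thesis by blast
qed

lemma trace_map_commute:
  fixes A B :: "'a::euclidean_space \<Rightarrow> 'a"
  assumes "linear A" "linear B"
  shows "trace_map (\<lambda>v. A (B v)) = trace_map (\<lambda>v. B (A v))"
proof -
  have exp: "F (G b) \<bullet> b = (\<Sum>c\<in>Basis. (G b \<bullet> c) * (F c \<bullet> b))"
    if F: "linear F" for F G :: "'a \<Rightarrow> 'a" and b
  proof -
    have "F (G b) = F (\<Sum>c\<in>Basis. (G b \<bullet> c) *\<^sub>R c)"
      by (simp add: euclidean_representation)
    then show ?thesis
      by (simp add: linear_sum[OF F] linear_scale[OF F] inner_sum_left)
  qed
  have "trace_map (\<lambda>v. A (B v)) = (\<Sum>b\<in>Basis. \<Sum>c\<in>Basis. (B b \<bullet> c) * (A c \<bullet> b))"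
    by (simp add: trace_map_def exp[OF assms(1)])
  also have "\<dots> = (\<Sum>c\<in>Basis. \<Sum>b\<in>Basis. (A c \<bullet> b) * (B b \<bullet> c))"
    by (subst sum.swap) (simp add: mult.commute)
  also have "\<dots> = trace_map (\<lambda>v. B (A v))"
    by (simp add: trace_map_def exp[OF assms(2)])
  finally show ?thesis .
qed

lemma trace_map_add: "trace_map (\<lambda>v. A v + B v) = trace_map A + trace_map B"
  by (simp add: trace_map_def inner_add_left sum.distrib)

lemma trace_map_diff: "trace_map (\<lambda>v. A v - B v) = trace_map A - trace_map B"
  by (simp add: trace_map_def inner_diff_left sum_subtractf)

lemma trace_map_scale: "trace_map (\<lambda>v. r *\<^sub>R A v) = r * trace_map A"
  by (simp add: trace_map_def sum_distrib_left)

lemma trace_map_zero: "trace_map (\<lambda>v. 0) = 0"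
  by (simp add: trace_map_def)

section \<open>The Killing form\<close>

text \<open>The Killing form \<open>K(x, y) = tr (ad x ad y)\<close>, with the trace taken over the whole algebra.\<close>

definition killing_form :: "('a::euclidean_space \<Rightarrow> 'a \<Rightarrow> 'a) \<Rightarrow> 'a \<Rightarrow> 'a \<Rightarrow> real" where
  "killing_form br x y = trace_map (\<lambda>v. br x (br y v))"

text \<open>The kernel of the Killing form.\<close>

definition killing_radical :: "('a::euclidean_space \<Rightarrow> 'a \<Rightarrow> 'a) \<Rightarrow> 'a set" where
  "killing_radical br = {x. \<forall>y. killing_form br x y = 0}"

locale real_lie_algebra =
  fixes br :: "'a::euclidean_space \<Rightarrow> 'a \<Rightarrow> 'a"
  assumes lie: "lie_algebra br"
begin

lemma bil: "bilinear br"
  using lie by (simp add: lie_algebra_def)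

lemmas br_simps = bilinear_ladd[OF bil] bilinear_radd[OF bil] bilinear_lsub[OF bil]
  bilinear_rsub[OF bil] bilinear_lmul[OF bil] bilinear_rmul[OF bil] bilinear_lneg[OF bil]
  bilinear_rneg[OF bil] bilinear_lzero[OF bil] bilinear_rzero[OF bil]

lemma br_self: "br x x = 0"
  using lie by (simp add: lie_algebra_def)

lemma br_anti: "br x y = - br y x"
  using br_self[of "x + y"] br_self[of x] br_self[of y]
  by (simp add: br_simps eq_neg_iff_add_eq_0 add.commute)

lemma jacobi: "br (br x y) z = br x (br y z) - br y (br x z)"
proof -
  have "br x (br y z) + br y (br z x) + br z (br x y) = 0"
    using lie by (simp add: lie_algebra_def)
  then show ?thesis
    using br_anti[of z "br x y"] br_anti[of z x] by (simp add: br_simps algebra_simps)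
qed

lemma linear_ad: "linear (br x)" "linear (\<lambda>x. br x y)"
  using bil by (auto simp: bilinear_def)

lemma ad_derivation: "br x \<in> derivations br"
  using linear_ad by (auto simp: derivations_def jacobi)

lemma derivation_diff:
  assumes "D \<in> derivations br" "E \<in> derivations br"
  shows "(\<lambda>v. D v - E v) \<in> derivations br"
  using assms by (auto simp: derivations_def br_simps algebra_simps intro: linear_compose_sub)

text \<open>
  Both sides are \<open>tr ([D, ad x] ad y)\<close>, by cyclicity of the trace and \<open>[D, ad x] = ad (D x)\<close>.
\<close>

lemma trace_derivation_br:
  assumes D: "D \<in> derivations br"
  shows "trace_map (\<lambda>v. D (br (br x y) v)) = killing_form br (D x) y"
proof -
  have lin: "linear D" and der: "D (br x y) = br (D x) y + br x (D y)" for x y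
    using D by (auto simp: derivations_def)
  have "trace_map (\<lambda>v. D (br (br x y) v)) =
      trace_map (\<lambda>v. D (br x (br y v))) - trace_map (\<lambda>v. D (br y (br x v)))"
    by (simp add: jacobi linear_diff[OF lin] trace_map_diff)
  also have "trace_map (\<lambda>v. D (br y (br x v))) = trace_map (\<lambda>v. br x (D (br y v)))"
    using trace_map_commute[of "\<lambda>v. D (br y v)" "br x"] linear_compose[OF linear_ad(1) lin]
    by (simp add: linear_ad o_def)
  also have "trace_map (\<lambda>v. D (br x (br y v))) =
      killing_form br (D x) y + trace_map (\<lambda>v. br x (D (br y v)))"
    by (simp add: der[of x] trace_map_add killing_form_def)
  finally show ?thesis by simp
qed

lemma killing_sym: "killing_form br x y = killing_form br y x"
  unfolding killing_form_def by (rule trace_map_commute) (rule linear_ad)+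

lemma killing_linear: "linear (\<lambda>x. killing_form br x y)"
  by (rule linearI) (simp_all add: killing_form_def br_simps trace_map_add trace_map_scale)

lemma killing_invariant: "killing_form br (br x y) z = - killing_form br y (br x z)"
proof -
  have *: "killing_form br (br x y) z = killing_form br x (br y z)" for x y z
    using trace_derivation_br[OF ad_derivation, of x y z] by (simp add: killing_form_def)
  have "killing_form br (br x y) z = - killing_form br (br y x) z"
    using linear_neg[OF killing_linear] br_anti[of x y] by simp
  then show ?thesis
    using *[of y x z] by simp
qed

lemma ideal_radical: "lie_ideal br (killing_radical br)"
  unfolding lie_ideal_def killing_radical_def
  by (auto intro!: subspaceI simp: linear_0[OF killing_linear] linear_add[OF killing_linear]
      linear_scale[OF killing_linear] killing_invariant)

lemma trace_derivation_ad_commutator_radical: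
  assumes D: "D \<in> derivations br"
    and x: "x \<in> span {br y z | y z. z \<in> killing_radical br}"
  shows "trace_map (\<lambda>v. D (br x v)) = 0"
proof -
  have lin: "linear D"
    using D by (auto simp: derivations_def)
  have "subspace {x. trace_map (\<lambda>v. D (br x v)) = 0}"
    by (rule subspaceI)
      (auto simp: br_simps linear_0[OF lin] linear_add[OF lin] linear_scale[OF lin]
        trace_map_zero trace_map_add trace_map_scale)
  moreover have "trace_map (\<lambda>v. D (br (br y z) v)) = 0" if "z \<in> killing_radical br" for y z
    using that killing_sym by (auto simp: trace_derivation_br[OF D] killing_radical_def)
  ultimately show ?thesis
    using span_minimal[of "{br y z | y z. z \<in> killing_radical br}"
        "{x. trace_map (\<lambda>v. D (br x v)) = 0}"] x by blast
qed

lemma ad_nilpotent_commutator_radical: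
  assumes "x \<in> span {br y z | y z. z \<in> killing_radical br}"
  shows "\<exists>m. \<forall>v. (br x ^^ m) v = 0"
  using nilpotent_if_trace_orthogonal_to_derivations[OF bil ad_derivation]
    trace_derivation_ad_commutator_radical[OF _ assms] by blast

section \<open>Engel's theorem\<close>

text \<open>
  Engel's theorem for a subalgebra \<open>L\<close> of ad-nilpotent elements acting on a quotient \<open>V / W\<close> of
  invariant subspaces. Stating it for pairs \<open>W \<subset> V\<close> lets the induction hypothesis be applied to a
  maximal proper subalgebra \<open>K\<close> acting on \<open>L / K\<close> without forming quotients.
\<close>

lemma engel:
  assumes "subspace L" "\<And>x y. x \<in> L \<Longrightarrow> y \<in> L \<Longrightarrow> br x y \<in> L"
    and "\<And>x. x \<in> L \<Longrightarrow> \<exists>m. \<forall>v. (br x ^^ m) v = 0"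
    and "subspace V" "subspace W" "W \<subset> V"
    and "\<And>x v. x \<in> L \<Longrightarrow> v \<in> V \<Longrightarrow> br x v \<in> V"
    and "\<And>x v. x \<in> L \<Longrightarrow> v \<in> W \<Longrightarrow> br x v \<in> W"
  shows "\<exists>v\<in>V - W. \<forall>x\<in>L. br x v \<in> W"
  using assms
proof (induction "dim L" arbitrary: L V W rule: less_induct)
  case less
  note L = less.prems(1) and sub = less.prems(2) and nil = less.prems(3)
  show ?case
  proof (cases "L = {0}")
    case True
    then show ?thesis
      using less.prems(5,6) by (auto simp: br_simps subspace_0)
  next
    case False
    define \<K> where "\<K> = {K. subspace K \<and> K \<subset> L \<and> (\<forall>x\<in>K. \<forall>y\<in>K. br x y \<in> K)}"
    have "{0} \<in> \<K>"
      using False L subspace_0[OF L] by (auto simp: \<K>_def br_simps)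
    moreover have "\<forall>K. K \<in> \<K> \<longrightarrow> dim K < Suc (dim L)"
      by (auto simp: \<K>_def intro!: le_imp_less_Suc dim_subset)
    ultimately obtain K where K: "K \<in> \<K>" and max: "\<And>K'. K' \<in> \<K> \<Longrightarrow> dim K' \<le> dim K"
      using ex_has_greatest_nat[of "\<lambda>K. K \<in> \<K>" "{0}" dim "Suc (dim L)"] by blast
    have Ks: "subspace K" and KL: "K \<subset> L" and Ksub: "\<And>x y. x \<in> K \<Longrightarrow> y \<in> K \<Longrightarrow> br x y \<in> K"
      using K by (auto simp: \<K>_def)
    have dimK: "dim K < dim L"
    proof (rule ccontr)
      assume "\<not> dim K < dim L"
      then have "K = L" using KL Ks L by (intro subspace_dim_equal) auto
      then show False using KL by simp
    qed
    have Knil: "\<And>x. x \<in> K \<Longrightarrow> \<exists>m. \<forall>v. (br x ^^ m) v = 0"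
      using KL nil by blast
    have "\<exists>v\<in>L - K. \<forall>x\<in>K. br x v \<in> K"
      by (rule less.hyps[OF dimK Ks Ksub Knil L Ks KL]) (use KL sub Ksub in auto)
    then obtain y where y: "y \<in> L" "y \<notin> K" and Ky: "\<And>x. x \<in> K \<Longrightarrow> br x y \<in> K"
      by blast
    \<comment> \<open>\<open>y\<close> normalises \<open>K\<close>, so \<open>K + \<real>y\<close> is a subalgebra, and equals \<open>L\<close> by maximality.\<close>
    define K' where "K' = {x + r *\<^sub>R y | x r. x \<in> K}"
    have K's: "subspace K'"
    proof (rule subspaceI)
      show "0 \<in> K'"
        unfolding K'_def using subspace_0[OF Ks] by (auto intro!: exI[of _ 0])
    next
      fix a b assume "a \<in> K'" "b \<in> K'"
      then obtain x r x' r' where "a = x + r *\<^sub>R y" "b = x' + r' *\<^sub>R y" "x \<in> K" "x' \<in> K"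
        unfolding K'_def by blast
      then have "a + b = (x + x') + (r + r') *\<^sub>R y" "x + x' \<in> K"
        using subspace_add[OF Ks] by (auto simp: algebra_simps)
      then show "a + b \<in> K'" unfolding K'_def by blast
    next
      fix c :: real and a assume "a \<in> K'"
      then obtain x r where "a = x + r *\<^sub>R y" "x \<in> K"
        unfolding K'_def by blast
      then have "c *\<^sub>R a = c *\<^sub>R x + (c * r) *\<^sub>R y" "c *\<^sub>R x \<in> K"
        using subspace_scale[OF Ks] by (auto simp: algebra_simps)
      then show "c *\<^sub>R a \<in> K'" unfolding K'_def by blast
    qed
    have KK': "K \<subset> K'"
    proof -
      have "x + r *\<^sub>R y \<in> K'" if "x \<in> K" for x r
        using that unfolding K'_def by blast
      from this[of 0 1] this[of _ 0] have "y \<in> K'" "K \<subseteq> K'"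
        using subspace_0[OF Ks] by auto
      then show ?thesis using y by blast
    qed
    have K'L: "K' \<subseteq> L"
      unfolding K'_def using KL y(1) L by (auto intro!: subspace_add subspace_scale)
    have K'sub: "br a b \<in> K'" if ab: "a \<in> K'" "b \<in> K'" for a b
    proof -
      obtain x r x' r' where e: "a = x + r *\<^sub>R y" "b = x' + r' *\<^sub>R y" and x: "x \<in> K" "x' \<in> K"
        using ab unfolding K'_def by blast
      have "br a b = br x x' + r' *\<^sub>R br x y - r *\<^sub>R br x' y"
        using br_anti[of y x'] by (simp add: e br_simps br_self algebra_simps)
      also have "\<dots> \<in> K"
        using x Ks Ksub Ky by (intro subspace_diff subspace_add subspace_scale) auto
      finally show ?thesis using KK' by blast
    qed
    have "K' = L"
    proof (rule ccontr)
      assume "K' \<noteq> L"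
      then have "K' \<in> \<K>" using K's K'L K'sub by (auto simp: \<K>_def)
      then have "K = K'"
        using max KK' Ks K's subspace_dim_equal[of K K'] by blast
      then show False using KK' by blast
    qed
    \<comment> \<open>The vectors killed by \<open>K\<close> modulo \<open>W\<close>; this space is stable under \<open>y\<close>, which acts nilpotently.\<close>
    define V' where "V' = {v \<in> V. \<forall>x\<in>K. br x v \<in> W}"
    have "\<exists>v\<in>V - W. \<forall>x\<in>K. br x v \<in> W"
      by (rule less.hyps[OF dimK Ks Ksub Knil less.prems(4-6)]) (use KL less.prems(7,8) in auto)
    then obtain v where v: "v \<in> V'" "v \<notin> W" unfolding V'_def by blast
    have yV': "br y u \<in> V'" if u: "u \<in> V'" for u
    proof -
      have "br x (br y u) \<in> W" if x: "x \<in> K" for x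
      proof -
        have "br x (br y u) = br (br x y) u + br y (br x u)"
          by (simp add: jacobi)
        moreover have "br (br x y) u \<in> W"
          using u x Ky by (auto simp: V'_def)
        moreover have "br y (br x u) \<in> W"
          using u x y less.prems(8) by (auto simp: V'_def)
        ultimately show ?thesis using subspace_add[OF less.prems(5)] by simp
      qed
      then show ?thesis using u y less.prems(7) by (auto simp: V'_def)
    qed
    have pow: "(br y ^^ j) v \<in> V'" for j
      by (induction j) (use v yV' in auto)
    obtain m where "(br y ^^ m) v = 0" using nil[OF y(1)] by blast
    then have "(br y ^^ m) v \<in> W" using subspace_0[OF less.prems(5)] by simp
    then obtain j where j: "(br y ^^ j) v \<notin> W" "(br y ^^ Suc j) v \<in> W"
      using v(2) ex_least_nat_less[of "\<lambda>j. (br y ^^ j) v \<in> W" m] by fastforce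
    let ?u = "(br y ^^ j) v"
    have "br a ?u \<in> W" if "a \<in> L" for a
    proof -
      obtain x r where a: "a = x + r *\<^sub>R y" "x \<in> K"
        using \<open>a \<in> L\<close> \<open>K' = L\<close> unfolding K'_def by blast
      have "br x ?u \<in> W" using pow a by (auto simp: V'_def)
      moreover have "br y ?u \<in> W" using j(2) by simp
      ultimately show ?thesis
        using less.prems(5) by (auto simp: a br_simps intro!: subspace_add subspace_scale)
    qed
    moreover have "?u \<in> V - W" using pow[of j] j(1) by (simp add: V'_def)
    ultimately show ?thesis by blast
  qed
qed

section \<open>Derivations are inner on the derived algebra\<close>

lemma radical_subset_center:
  assumes red: "lie_reductive br" and triv: "lie_center br \<inter> lie_derived br = {0}"
  shows "killing_radical br \<subseteq> lie_center br"
proof -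
  let ?N = "killing_radical br"
  define M where "M = span {br y z | y z. z \<in> ?N}"
  have gen: "br y z \<in> M" if "z \<in> ?N" for y z
    unfolding M_def using that by (blast intro: span_base)
  have Ms: "subspace M" by (simp add: M_def)
  have "M \<subseteq> ?N"
    unfolding M_def by (rule span_minimal) (use ideal_radical in \<open>auto simp: lie_ideal_def\<close>)
  then have M: "lie_ideal br M"
    using gen Ms by (auto simp: lie_ideal_def)
  have "M \<subseteq> lie_derived br"
    unfolding M_def lie_derived_def by (rule span_mono) blast
  obtain J where J: "lie_ideal br J" and MJ: "complementary M J"
    using red M unfolding lie_reductive_def by blast
  have "M = {0}"
  proof (rule ccontr)
    assume "M \<noteq> {0}"
    then have ne: "{0} \<subset> M" using subspace_0[OF Ms] by blast
    have "\<exists>z\<in>M - {0}. \<forall>x\<in>M. br x z \<in> {0}"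
      by (rule engel[OF Ms _ _ Ms _ ne])
        (use M ad_nilpotent_commutator_radical in \<open>auto simp: lie_ideal_def br_simps M_def[symmetric]\<close>)
    then obtain z where z: "z \<in> M" "z \<noteq> 0" "\<And>x. x \<in> M \<Longrightarrow> br x z = 0"
      by blast
    have "br z x = 0" for x
    proof -
      obtain u v where x: "x = u + v" "u \<in> M" "v \<in> J"
        using MJ unfolding complementary_def by blast
      have "br z v \<in> J" using J x by (auto simp: lie_ideal_def)
      moreover have "br v z \<in> M" using M z by (auto simp: lie_ideal_def)
      then have "br z v \<in> M" using br_anti[of z v] subspace_neg[OF Ms] by simp
      ultimately have "br z v = 0" using MJ by (auto simp: complementary_def)
      moreover have "br z u = 0" using z(3)[OF x(2)] br_anti[of z u] by simp
      ultimately show ?thesis by (simp add: x br_simps)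
    qed
    then have "z \<in> lie_center br \<inter> lie_derived br"
      using z \<open>M \<subseteq> lie_derived br\<close> by (auto simp: lie_center_def)
    then show False using triv z by blast
  qed
  then have "br z y = 0" if "z \<in> ?N" for z y
    using gen[OF that, of y] br_anti[of z y] by auto
  then show ?thesis by (auto simp: lie_center_def)
qed

text \<open>
  Let \<open>k\<close> represent the Killing form in the scalar product and let \<open>d\<close> represent the functional
  \<open>y \<mapsto> tr (D ad y)\<close>. The operator \<open>k\<close> is self-adjoint with central kernel and \<open>d\<close> is orthogonal to
  the centre, so \<open>d\<close> lies in the range of \<open>k\<close>.
\<close>

lemma trace_ad_eq_killing:
  assumes rad: "killing_radical br \<subseteq> lie_center br" and lin: "linear D"
  obtains w where "\<And>y. trace_map (\<lambda>v. D (br y v)) = killing_form br w y"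
proof -
  have linD: "linear (\<lambda>y. trace_map (\<lambda>v. D (br y v)))"
    by (rule linearI)
      (simp_all add: br_simps linear_add[OF lin] linear_scale[OF lin] trace_map_add
        trace_map_scale)
  have rep: "f y = (\<Sum>b\<in>Basis. f b *\<^sub>R b) \<bullet> y" if f: "linear f" for f :: "'a \<Rightarrow> real" and y
  proof -
    have "f y = f (\<Sum>b\<in>Basis. (y \<bullet> b) *\<^sub>R b)" by (simp add: euclidean_representation)
    also have "\<dots> = (\<Sum>b\<in>Basis. f b * (b \<bullet> y))"
      by (simp add: linear_sum[OF f] linear_scale[OF f] inner_commute[of y] mult.commute)
    finally show ?thesis by (simp add: inner_sum_left)
  qed
  define d where "d = (\<Sum>b\<in>Basis. trace_map (\<lambda>v. D (br b v)) *\<^sub>R b)"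
  define k where "k w = (\<Sum>b\<in>Basis. killing_form br w b *\<^sub>R b)" for w
  have k: "k w \<bullet> y = killing_form br w y" for w y
  proof -
    have "linear (killing_form br w)"
      using killing_linear[of w] unfolding killing_sym[of _ w] .
    from rep[OF this, of y] show ?thesis by (simp add: k_def)
  qed
  have d: "d \<bullet> y = trace_map (\<lambda>v. D (br y v))" for y
    using rep[OF linD, of y] by (simp add: d_def)
  have "linear k"
    unfolding k_def
    by (rule linearI)
      (simp_all add: linear_add[OF killing_linear] linear_scale[OF killing_linear]
        scaleR_add_left sum.distrib scaleR_sum_right)
  then have R: "subspace (range k)" by (simp add: linear_subspace_image)
  have sp: "span (range k) = range k" using R by (simp add: span_eq_iff)
  obtain p q where pq: "p \<in> range k" "\<And>u. u \<in> range k \<Longrightarrow> q \<bullet> u = 0" "d = p + q"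
    by (rule orthogonal_subspace_decomp_exists[of "range k" d, unfolded sp real_inner_class.orthogonal_def])
      (rule that)
  have "killing_form br q y = 0" for y
    using pq(2)[of "k y"] k[of y q] killing_sym[of q y]
    by (simp add: inner_commute[of q])
  then have "q \<in> lie_center br" using rad by (auto simp: killing_radical_def)
  then have "d \<bullet> q = 0"
    by (simp add: d lie_center_def linear_0[OF lin] trace_map_zero)
  moreover have "p \<bullet> q = 0"
    using pq(2)[OF pq(1)] by (simp add: inner_commute)
  ultimately have "q = 0" by (simp add: pq(3) inner_add_left)
  then obtain w where "d = k w" using pq by auto
  then show thesis using that[of w] k d by metis
qed

lemma derivation_inner_on_derived:
  assumes rad: "killing_radical br \<subseteq> lie_center br" and D: "D \<in> derivations br"
  obtains w where "\<And>x. x \<in> lie_derived br \<Longrightarrow> D x = br w x"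
proof -
  have lin: "linear D" using D by (auto simp: derivations_def)
  obtain w where w: "\<And>y. trace_map (\<lambda>v. D (br y v)) = killing_form br w y"
    using trace_ad_eq_killing[OF rad lin] by blast
  define E where "E v = D v - br w v" for v
  have E: "E \<in> derivations br"
    unfolding E_def by (rule derivation_diff[OF D ad_derivation])
  then have linE: "linear E" and derE: "E (br x y) = br (E x) y + br x (E y)" for x y
    by (auto simp: derivations_def)
  have "killing_form br (E x) y = 0" for x y
    using trace_derivation_br[OF E, of x y] w[of "br x y"]
    by (simp add: E_def trace_map_diff killing_form_def)
  then have cen: "E x \<in> lie_center br" for x
    using rad by (auto simp: killing_radical_def)
  have "E (br x y) = 0" for x y
    using cen[of x] cen[of y] br_anti[of x "E y"] by (simp add: derE lie_center_def)
  moreover have "subspace {x. E x = 0}"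
    by (rule subspaceI) (auto simp: linear_0[OF linE] linear_add[OF linE] linear_scale[OF linE])
  ultimately have "lie_derived br \<subseteq> {x. E x = 0}"
    unfolding lie_derived_def by (intro span_minimal) auto
  then show thesis using that[of w] by (auto simp: E_def)
qed

lemma derivation_center:
  assumes D: "D \<in> derivations br" and x: "x \<in> lie_center br"
  shows "D x \<in> lie_center br"
proof -
  have "br (D x) y = 0" for y
  proof -
    have "D (br x y) = br (D x) y + br x (D y)" "linear D"
      using D by (auto simp: derivations_def)
    then show ?thesis using x by (simp add: lie_center_def linear_0)
  qed
  then show ?thesis by (simp add: lie_center_def)
qed

end

section \<open>Modifications of a reductive algebra with one-dimensional centre\<close>

theorem lemma2:
  fixes br :: "'a::euclidean_space \<Rightarrow> 'a \<Rightarrow> 'a"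
    and \<phi> :: "'a \<Rightarrow> 'a \<Rightarrow> 'a"
  assumes "lie_algebra br"
    and "lie_reductive br"
    and "dim (lie_center br) = 1"
    and "complementary (lie_center br) (lie_derived br)"
    and "modification br \<phi>"
  shows "lie_isomorphic (modified_bracket br \<phi>) br"
proof -
  interpret real_lie_algebra br by unfold_locales (rule assms)
  let ?Z = "lie_center br" and ?S = "lie_derived br"
  have Zs: "subspace ?Z" and Ss: "subspace ?S" and ZS: "?Z \<inter> ?S = {0}"
    and sum: "\<And>x. \<exists>z s. x = z + s \<and> z \<in> ?Z \<and> s \<in> ?S"
    using assms(4) unfolding complementary_def by blast+
  have \<phi>: "\<And>x. \<phi> x \<in> skew_derivations br" and \<phi>lin: "\<And>v. linear (\<lambda>x. \<phi> x v)"
    and \<phi>S: "\<And>z v. z \<in> ?S \<Longrightarrow> \<phi> z v = 0"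
    using assms(5) by (auto simp: modification_def)
  have brS: "br x y \<in> ?S" for x y
    unfolding lie_derived_def by (rule span_base) blast
  obtain e where e: "e \<in> ?Z" "e \<noteq> 0"
  proof -
    have "\<not> ?Z \<subseteq> {0}" using assms(3) by (metis dim_eq_0 zero_neq_one)
    then show thesis using that by blast
  qed
  have Z: "\<exists>r. z = r *\<^sub>R e" if "z \<in> ?Z" for z
  proof -
    have "span {e} = ?Z"
      using subspace_dim_equal[of "span {e}" ?Z] e Zs assms(3) span_minimal[of "{e}" ?Z] by auto
    then show ?thesis using that by (auto simp: span_singleton)
  qed
  have eS: "r = 0" if "r *\<^sub>R e \<in> ?S" for r
  proof -
    have "r *\<^sub>R e \<in> ?Z \<inter> ?S" using that subspace_scale[OF Zs e(1)] by blast
    then show ?thesis using e ZS by simp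
  qed
  \<comment> \<open>the coordinate along \<open>e\<close>\<close>
  define a where "a x = (THE r. x - r *\<^sub>R e \<in> ?S)" for x
  have a_uniq: "a x = r" if "x - r *\<^sub>R e \<in> ?S" for x r
    unfolding a_def
  proof (rule the_equality)
    show "x - r *\<^sub>R e \<in> ?S" by (rule that)
    fix s assume "x - s *\<^sub>R e \<in> ?S"
    from subspace_diff[OF Ss that this] have "(s - r) *\<^sub>R e \<in> ?S"
      by (simp add: algebra_simps)
    then show "s = r" using eS by fastforce
  qed
  have a: "x - a x *\<^sub>R e \<in> ?S" for x
  proof -
    obtain z s where "x = z + s" "z \<in> ?Z" "s \<in> ?S" using sum by blast
    moreover obtain r where "z = r *\<^sub>R e" using Z \<open>z \<in> ?Z\<close> by blast
    ultimately have "x - r *\<^sub>R e \<in> ?S" by simp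
    then show ?thesis using a_uniq by metis
  qed
  have a_lin: "linear a"
  proof (rule linearI)
    fix x y and c :: real
    have "(x + y) - (a x + a y) *\<^sub>R e = (x - a x *\<^sub>R e) + (y - a y *\<^sub>R e)"
      by (simp add: algebra_simps)
    then show "a (x + y) = a x + a y"
      using a_uniq subspace_add[OF Ss a a] by metis
    have "c *\<^sub>R x - (c *\<^sub>R a x) *\<^sub>R e = c *\<^sub>R (x - a x *\<^sub>R e)"
      by (simp add: algebra_simps)
    then show "a (c *\<^sub>R x) = c *\<^sub>R a x"
      using a_uniq subspace_scale[OF Ss a] by metis
  qed
  have aS: "a s = 0" if "s \<in> ?S" for s
    using a_uniq[of s 0] that by simp

  define D where "D = \<phi> e"
  have D: "D \<in> derivations br" and skew: "\<And>x y. D x \<bullet> y = - (x \<bullet> D y)"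
    using \<phi>[of e] by (auto simp: D_def skew_derivations_def skew_endomorphisms_def)
  have linD: "linear D" using D by (auto simp: derivations_def)
  have \<phi>_eq: "\<phi> x y = a x *\<^sub>R D y" for x y
    using \<phi>S[OF a, of x y] linear_diff[OF \<phi>lin, of x "a x *\<^sub>R e" y]
      linear_scale[OF \<phi>lin, of "a x" e y] by (simp add: D_def)
  have De: "D e = 0"
  proof -
    obtain c where "D e = c *\<^sub>R e" using Z[OF derivation_center[OF D e(1)]] by blast
    then show ?thesis using skew[of e e] e by auto
  qed
  have "killing_radical br \<subseteq> ?Z"
    using radical_subset_center assms(2) ZS by blast
  then obtain w' where w': "\<And>x. x \<in> ?S \<Longrightarrow> D x = br w' x"
    using derivation_inner_on_derived D by blast
  \<comment> \<open>Discarding the central component of \<open>w'\<close> keeps \<open>ad w'\<close> and makes \<open>a w = 0\<close>, on which the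
    bijectivity of \<open>f\<close> below depends.\<close>
  define w where "w = w' - a w' *\<^sub>R e"
  have w: "w \<in> ?S" using a by (simp add: w_def)
  have e0: "br e x = 0" "br x e = 0" for x
    using e(1) br_anti[of x e] by (auto simp: lie_center_def)
  have Dw: "D x = br w x" for x
  proof -
    have "D x = D (x - a x *\<^sub>R e)"
      by (simp add: linear_diff[OF linD] linear_scale[OF linD] De)
    also have "\<dots> = br w x"
      using w'[OF a] by (simp add: w_def br_simps e0)
    finally show ?thesis .
  qed
  define f where "f x = x + a x *\<^sub>R w" for x
  have fS: "f s = s" if "s \<in> ?S" for s
    using that by (simp add: f_def aS)
  have bracket: "modified_bracket br \<phi> x y = br (f x) (f y)" for x y
    using br_anti[of x w]
    by (simp add: modified_bracket_def \<phi>_eq Dw f_def br_simps br_self)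
  have "linear f"
    by (rule linearI) (simp_all add: f_def linear_add[OF a_lin] linear_scale[OF a_lin] algebra_simps)
  moreover have "bij f"
  proof (rule o_bij)
    show "(\<lambda>x. x - a x *\<^sub>R w) \<circ> f = id" "f \<circ> (\<lambda>x. x - a x *\<^sub>R w) = id"
      by (auto simp: f_def fun_eq_iff linear_add[OF a_lin] linear_diff[OF a_lin]
          linear_scale[OF a_lin] aS[OF w])
  qed
  moreover have "f (modified_bracket br \<phi> x y) = br (f x) (f y)" for x y
    by (simp add: bracket fS brS)
  ultimately show ?thesis
    unfolding lie_isomorphic_def by blast
qed

end
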